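(* Let $\mathfrak{K}$ be a family of nonempty c.e. sets and let $E^{\mathrm{ce}}$ be an equivalence relation on $\omega$ extending $=^{\mathrm{ce}}$. Then $\mathfrak{K}$ is $E^{\mathrm{ce}}$-learnable if and only if for every $W_e\in\mathfrak{K}$ there exists a tell-tale, that is, a finite set $D_{W_e}\subseteq W_e$ such that for every $W_{e'}\in\mathfrak{K}$ for which $e'\mathrel{E^{\mathrm{ce}}}e$ fails, if $D_{W_e}\subseteq W_{e'}$, then $W_{e'}\nsubseteq W_e$.
   Context: Fix a standard (acceptable) enumeration $(\varphi_e)_{e\in\omega}$ of the partial computable functions and let $W_e=\operatorname{dom}(\varphi_e)$. Write $e=^{\mathrm{ce}}e'$ iff $W_e=W_{e'}$. Equivalence relations on $\omega$ extending $=^{\mathrm{ce}}$ are arbitrary (no definability or effectivity is assumed). An enumeration of a set $A$ is a surjection $\mu:\omega\to A$; $\mu[s]$ denotes the finite string $\mu(0),\dots,\mu(s-1)$. A learner is an arbitrary function $\mathbf{M}:\omega^{<\omega}\to\omega$ (no effectivity is assumed). A family $\mathfrak{K}$ of nonempty c.e. sets is $E^{\mathrm{ce}}$-learnable if there is a learner $\mathbf{M}$ such that for every $e$ with $W_e\in\mathfrak{K}$ and every enumeration $\mu$ of $W_e$ there is $i\in\omega$ with $i\mathrel{E^{\mathrm{ce}}}e$ and $\mathbf{M}(\mu[s])=i$ for all sufficiently large $s$. *)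

theory Defs
  imports Complex_Main
begin

text \<open>
  Kleene's partial recursive functions, given by programs and their big-step semantics.
  Programs carry no arity: \<open>Zero\<close> and \<open>Proj i\<close> apply to argument lists of any (sufficient) length,
  and a computation with a mismatched number of arguments simply has no result.
  The recursion variable of \<open>PrimRec\<close> and the search variable of \<open>Minimise\<close> come first.
\<close>

datatype prog =
    Zero
  | Succ
  | Proj nat
  | Compose prog "prog list"
  | PrimRec prog prog
  | Minimise prog

inductive computes :: "prog \<Rightarrow> nat list \<Rightarrow> nat \<Rightarrow> bool" where
  Zero: "computes Zero xs 0"
| Succ: "computes Succ [x] (Suc x)"
| Proj: "i < length xs \<Longrightarrow> computes (Proj i) xs (xs ! i)"
| Compose: "list_all2 (\<lambda>q y. computes q xs y) qs ys \<Longrightarrow> computes p ys z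
    \<Longrightarrow> computes (Compose p qs) xs z"
| PrimRec_0: "computes p xs y \<Longrightarrow> computes (PrimRec p q) (0 # xs) y"
| PrimRec_Suc: "computes (PrimRec p q) (n # xs) r \<Longrightarrow> computes q (n # r # xs) y
    \<Longrightarrow> computes (PrimRec p q) (Suc n # xs) y"
| Minimise: "computes p (n # xs) 0 \<Longrightarrow> (\<And>m. m < n \<Longrightarrow> \<exists>k. computes p (m # xs) (Suc k))
    \<Longrightarrow> computes (Minimise p) xs n"

lemma computes_deterministic:
  "computes p xs y \<Longrightarrow> computes p xs z \<Longrightarrow> y = z"
proof (induction arbitrary: z rule: computes.induct)
  case (Zero xs)
  then show ?case by (auto elim: computes.cases)
next
  case (Succ x)
  then show ?case by (auto elim: computes.cases)
next
  case (Proj i xs)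
  from Proj.prems show ?case by (cases rule: computes.cases) auto
next
  case (Compose xs qs ys p w)
  from Compose.prems obtain zs where zs: "list_all2 (\<lambda>q y. computes q xs y) qs zs" "computes p zs z"
    by (cases rule: computes.cases) auto
  have "ys = zs"
    using Compose.IH(1) zs(1) by (auto simp: list_all2_conv_all_nth intro!: nth_equalityI)
  with zs(2) Compose.IH(2) show ?case by blast
next
  case (PrimRec_0 p xs y q)
  from PrimRec_0.prems show ?case by (cases rule: computes.cases) (auto intro: PrimRec_0.IH)
next
  case (PrimRec_Suc p q n xs r y)
  from PrimRec_Suc.prems obtain r' where "computes (PrimRec p q) (n # xs) r'" "computes q (n # r' # xs) z"
    by (cases rule: computes.cases) auto
  with PrimRec_Suc.IH show ?case by metis
next
  case (Minimise p n xs)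
  from Minimise.prems have z: "computes p (z # xs) 0" "\<And>m. m < z \<Longrightarrow> \<exists>k. computes p (m # xs) (Suc k)"
    by (cases rule: computes.cases, auto)+
  have "\<not> z < n" using Minimise.IH(2) z(1) by fastforce
  moreover have "\<not> n < z" using Minimise.IH(1) z(2) by fastforce
  ultimately show ?case by simp
qed

definition partial_computable :: "(nat \<Rightarrow> nat option) \<Rightarrow> bool" where
  "partial_computable f \<longleftrightarrow> (\<exists>p. \<forall>x y. f x = Some y \<longleftrightarrow> computes p [x] y)"

definition partial_computable2 :: "(nat \<Rightarrow> nat \<Rightarrow> nat option) \<Rightarrow> bool" where
  "partial_computable2 f \<longleftrightarrow> (\<exists>p. \<forall>x y z. f x y = Some z \<longleftrightarrow> computes p [x, y] z)"

definition total_computable :: "(nat \<Rightarrow> nat) \<Rightarrow> bool" where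
  "total_computable f \<longleftrightarrow> partial_computable (\<lambda>x. Some (f x))"

text \<open>
  Acceptable enumerations: every partial computable function (and nothing else) is listed,
  the enumeration has a computable universal function, and it satisfies the s-m-n property.
  The first clause follows from the other two.
\<close>

definition acceptable_enumeration :: "(nat \<Rightarrow> nat \<Rightarrow> nat option) \<Rightarrow> bool" where
  "acceptable_enumeration \<phi> \<longleftrightarrow>
     range \<phi> = {f. partial_computable f} \<and>
     partial_computable2 \<phi> \<and>
     (\<forall>\<psi>. partial_computable2 \<psi> \<longrightarrow> (\<exists>s. total_computable s \<and> (\<forall>e. \<phi> (s e) = \<psi> e)))"

definition ce_set :: "nat set \<Rightarrow> bool" where
  "ce_set A \<longleftrightarrow> (\<exists>f. partial_computable f \<and> A = dom f)"

definition W :: "(nat \<Rightarrow> nat \<Rightarrow> nat option) \<Rightarrow> nat \<Rightarrow> nat set" where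
  "W \<phi> e = dom (\<phi> e)"

definition ce_equality :: "(nat \<Rightarrow> nat \<Rightarrow> nat option) \<Rightarrow> nat rel" where
  "ce_equality \<phi> = {(e, e'). W \<phi> e = W \<phi> e'}"

definition enumeration_of :: "(nat \<Rightarrow> nat) \<Rightarrow> nat set \<Rightarrow> bool" where
  "enumeration_of \<mu> A \<longleftrightarrow> range \<mu> = A"

definition initial_segment :: "(nat \<Rightarrow> nat) \<Rightarrow> nat \<Rightarrow> nat list" where
  "initial_segment \<mu> s = map \<mu> [0..<s]"

definition learnable ::
  "(nat \<Rightarrow> nat \<Rightarrow> nat option) \<Rightarrow> nat rel \<Rightarrow> nat set set \<Rightarrow> bool" where
  "learnable \<phi> E K \<longleftrightarrow>
     (\<exists>M :: nat list \<Rightarrow> nat. \<forall>e. W \<phi> e \<in> K \<longrightarrow>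
        (\<forall>\<mu>. enumeration_of \<mu> (W \<phi> e) \<longrightarrow>
           (\<exists>i. (i, e) \<in> E \<and> (\<forall>\<^sub>F s in sequentially. M (initial_segment \<mu> s) = i))))"

definition tell_tale ::
  "(nat \<Rightarrow> nat \<Rightarrow> nat option) \<Rightarrow> nat rel \<Rightarrow> nat set set \<Rightarrow> nat \<Rightarrow> nat set \<Rightarrow> bool" where
  "tell_tale \<phi> E K e D \<longleftrightarrow>
     finite D \<and> D \<subseteq> W \<phi> e \<and>
     (\<forall>e'. W \<phi> e' \<in> K \<longrightarrow> (e', e) \<notin> E \<longrightarrow> D \<subseteq> W \<phi> e' \<longrightarrow> \<not> W \<phi> e' \<subseteq> W \<phi> e)"

end

theory Submission imports Defs begin

text \<open>
  If a learner had no locking sequence for \<open>A\<close>, that is, no string over \<open>A\<close> after which it never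
  changes its mind on data from \<open>A\<close>, one could interleave mind changes with an enumeration of \<open>A\<close>
  and defeat it. The content of a locking sequence is a tell-tale: a subset of \<open>A\<close> containing it has
  an enumeration that starts with the locking sequence, so it receives the same conjecture.
  Conversely, given tell-tales \<open>D\<close>, the learner conjectures the least index \<open>i\<close> of a member of the
  family for which the data seen so far lie between \<open>D i\<close> and \<open>W\<^sub>i\<close>.
\<close>

lemma length_initial_segment [simp]: "length (initial_segment \<mu> s) = s"
  by (simp add: initial_segment_def)

lemma set_initial_segment [simp]: "set (initial_segment \<mu> s) = \<mu> ` {..<s}"
  by (simp add: initial_segment_def lessThan_atLeast0)

lemma initial_segment_add:
  "initial_segment \<mu> (m + n) = initial_segment \<mu> m @ map \<mu> [m..<m + n]"
  by (simp add: initial_segment_def upt_add_eq_append [OF le0])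

lemma exists_enumeration:
  assumes "A \<noteq> {}"
  shows "\<exists>\<mu>. enumeration_of \<mu> A"
proof -
  obtain a where "a \<in> A" using assms by blast
  then have "range (\<lambda>n. if n \<in> A then n else a) = A" by auto
  then show ?thesis unfolding enumeration_of_def by blast
qed

text \<open>Put \<open>\<sigma>\<close> in front of an arbitrary enumeration of \<open>A\<close>:
  the range stays \<open>A\<close> because the entries of \<open>\<sigma>\<close> lie in
  \<open>A\<close>.\<close>

lemma exists_enumeration_extending:
  assumes "A \<noteq> {}" "set \<sigma> \<subseteq> A"
  obtains \<mu> where "enumeration_of \<mu> A" "initial_segment \<mu> (length \<sigma>) = \<sigma>"
proof -
  obtain f :: "nat \<Rightarrow> nat" where f: "A = range f"
    using exists_enumeration [OF assms(1)] by (auto simp: enumeration_of_def)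
  define \<mu> where "\<mu> k = (if k < length \<sigma> then \<sigma> ! k else f (k - length \<sigma>))" for k
  have "f n \<in> range \<mu>" for n
    by (rule range_eqI [of _ _ "length \<sigma> + n"]) (simp add: \<mu>_def)
  moreover have "\<mu> k \<in> A" for k
    using assms(2) nth_mem [of k \<sigma>] by (auto simp: \<mu>_def f)
  ultimately have "enumeration_of \<mu> A"
    unfolding enumeration_of_def f by blast
  moreover have "initial_segment \<mu> (length \<sigma>) = \<sigma>"
    by (rule nth_equalityI) (simp_all add: initial_segment_def \<mu>_def)
  ultimately show thesis by (rule that)
qed

text \<open>Each step appends at least one entry and never alters earlier ones, so the value at any
  position is settled after finitely many steps and can be read off there.\<close>

lemma chain_of_prefixes_limit:
  fixes S :: "nat \<Rightarrow> nat list"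
  assumes step: "\<And>n. \<exists>\<rho>. \<rho> \<noteq> [] \<and> S (Suc n) = S n @ \<rho>"
  obtains \<mu> where "\<And>n. initial_segment \<mu> (length (S n)) = S n" "\<And>n. n \<le> length (S n)"
proof -
  have len: "n \<le> length (S n)" for n
  proof (induction n)
    case (Suc n)
    then show ?case using step [of n] by (auto simp: Suc_le_eq neq_Nil_conv)
  qed simp
  have stable: "k < length (S m) \<Longrightarrow> m \<le> n \<Longrightarrow> k < length (S n) \<and> S n ! k = S m ! k" for k m n
  proof (induction n rule: nat_induct)
    case (Suc n)
    then show ?case using step [of n] by (cases "m = Suc n") (auto simp: nth_append)
  qed simp
  \<comment> \<open>\<open>S k\<close> may have length exactly \<open>k\<close>;
    \<open>S (Suc k)\<close> is sure to have an entry at position \<open>k\<close>.\<close>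
  define \<mu> where "\<mu> k = S (Suc k) ! k" for k
  have "\<mu> k = S n ! k" if "k < length (S n)" for n k
  proof (cases "n \<le> Suc k")
    case True
    then show ?thesis using stable [OF that True] by (simp add: \<mu>_def)
  next
    case False
    moreover have "k < length (S (Suc k))" using len [of "Suc k"] by simp
    ultimately show ?thesis using stable [of k "Suc k" n] by (simp add: \<mu>_def)
  qed
  then have "initial_segment \<mu> (length (S n)) = S n" for n
    by (intro nth_equalityI) (simp_all add: initial_segment_def)
  then show thesis using len by (rule that)
qed

lemma exists_locking_sequence:
  fixes M :: "nat list \<Rightarrow> nat"
  assumes "A \<noteq> {}"
    and conv: "\<And>\<mu>. enumeration_of \<mu> A \<Longrightarrow> \<exists>i. \<forall>\<^sub>F s in sequentially. M (initial_segment \<mu> s) = i"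
  obtains \<sigma> where "set \<sigma> \<subseteq> A" "\<And>\<tau>. set \<tau> \<subseteq> A \<Longrightarrow> M (\<sigma> @ \<tau>) = M \<sigma>"
proof (rule ccontr)
  assume "\<not> thesis"
  then have "\<forall>\<sigma>. \<exists>\<tau>. set \<sigma> \<subseteq> A \<longrightarrow> set \<tau> \<subseteq> A \<and> M (\<sigma> @ \<tau>) \<noteq> M \<sigma>"
    using that by blast
  then obtain T where T: "\<And>\<sigma>. set \<sigma> \<subseteq> A \<Longrightarrow> set (T \<sigma>) \<subseteq> A \<and> M (\<sigma> @ T \<sigma>) \<noteq> M \<sigma>"
    by metis
  obtain f :: "nat \<Rightarrow> nat" where f: "A = range f"
    using exists_enumeration [OF assms(1)] by (auto simp: enumeration_of_def)
  \<comment> \<open>\<open>T \<sigma>\<close> forces a mind change, while \<open>f n\<close> makes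
    the limit exhaust \<open>A\<close> and keeps every step nonempty.\<close>
  define S where "S = rec_nat [] (\<lambda>n \<sigma>. \<sigma> @ T \<sigma> @ [f n])"
  have S: "S 0 = []" "\<And>n. S (Suc n) = S n @ T (S n) @ [f n]"
    by (simp_all add: S_def)
  have S_sub: "set (S n) \<subseteq> A" for n
  proof (induction n)
    case (Suc n)
    then show ?case using T [of "S n"] f by (auto simp: S(2))
  qed (simp add: S(1))
  obtain \<mu> where \<mu>: "\<And>n. initial_segment \<mu> (length (S n)) = S n" "\<And>n. n \<le> length (S n)"
    by (rule chain_of_prefixes_limit [of S]) (auto simp: S(2))
  have set_S: "set (S n) \<subseteq> range \<mu>" for n
    by (subst \<mu>(1) [symmetric]) auto
  have "\<mu> k \<in> A" for k
  proof -
    have "\<mu> k \<in> set (initial_segment \<mu> (length (S (Suc k))))"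
      using \<mu>(2) [of "Suc k"] by auto
    then show ?thesis unfolding \<mu>(1) using S_sub by blast
  qed
  moreover have "f n \<in> range \<mu>" for n
    using set_S [of "Suc n"] by (auto simp: S(2))
  ultimately have "enumeration_of \<mu> A"
    unfolding enumeration_of_def f by blast
  then obtain i N where N: "\<And>s. s \<ge> N \<Longrightarrow> M (initial_segment \<mu> s) = i"
    using conv by (force simp: eventually_sequentially)
  \<comment> \<open>Dropping the final entry \<open>f N\<close> from \<open>S (Suc N)\<close> shows
    that \<open>S N @ T (S N)\<close> is also an initial segment of \<open>\<mu>\<close>. Both it
    and \<open>S N\<close> have length at least \<open>N\<close>, so \<open>M\<close> gives
    \<open>i\<close> on both.\<close>
  let ?s = "length (S N @ T (S N))"
  have "initial_segment \<mu> ?s @ [\<mu> ?s] = initial_segment \<mu> (length (S (Suc N)))"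
    by (simp add: initial_segment_def S(2))
  also have "\<dots> = (S N @ T (S N)) @ [f N]"
    by (simp add: \<mu>(1), simp add: S(2))
  finally have "initial_segment \<mu> ?s = S N @ T (S N)"
    unfolding append1_eq_conv by simp
  then have "M (S N @ T (S N)) = i"
    using N [of ?s] \<mu>(2) [of N] by simp
  moreover have "M (S N) = i"
    using N [OF \<mu>(2) [of N]] by (simp add: \<mu>(1))
  ultimately show False
    using T [OF S_sub [of N]] by simp
qed

text \<open>Only the finitely many indices up to the least solution of \<open>Q\<close> matter, so
  their separate limits can be combined; larger indices cannot affect the minimum.\<close>

lemma eventually_const_Least:
  fixes P :: "nat \<Rightarrow> nat \<Rightarrow> bool"
  assumes lim: "\<And>i. \<forall>\<^sub>F s in F. P s i \<longleftrightarrow> Q i" and "Q e"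
  shows "\<forall>\<^sub>F s in F. (LEAST i. P s i) = (LEAST i. Q i)"
proof -
  have "\<forall>\<^sub>F s in F. \<forall>i\<in>{..(LEAST i. Q i)}. P s i \<longleftrightarrow> Q i"
    by (intro eventually_ball_finite) (auto intro: lim)
  then show ?thesis
  proof eventually_elim
    case (elim s)
    have "Q (LEAST i. Q i)" using \<open>Q e\<close> by (rule LeastI)
    show ?case
    proof (rule Least_equality)
      show "P s (LEAST i. Q i)" using elim \<open>Q (LEAST i. Q i)\<close> by simp
    next
      fix i assume "P s i"
      then show "(LEAST i. Q i) \<le> i"
        using elim Least_le [of Q i] by (cases "i \<le> (LEAST i. Q i)") auto
    qed
  qed
qed

text \<open>Finiteness of \<open>D\<close> gives one stage by which all its elements found in the
  range have appeared.\<close>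

lemma eventually_subset_prefix_iff:
  fixes \<mu> :: "nat \<Rightarrow> 'a"
  assumes "finite D"
  shows "\<forall>\<^sub>F s in sequentially. D \<subseteq> \<mu> ` {..<s} \<longleftrightarrow> D \<subseteq> range \<mu>"
proof (cases "D \<subseteq> range \<mu>")
  case True
  have "\<forall>\<^sub>F s in sequentially. \<forall>d\<in>D. d \<in> \<mu> ` {..<s}"
  proof (rule eventually_ball_finite [OF assms], rule ballI)
    fix d assume "d \<in> D"
    then obtain k where "d = \<mu> k" using True by auto
    then show "\<forall>\<^sub>F s in sequentially. d \<in> \<mu> ` {..<s}"
      by (auto intro: eventually_mono [OF eventually_gt_at_top [of k]])
  qed
  then show ?thesis
    by eventually_elim (use True in blast)
next
  case False
  then show ?thesis by (intro always_eventually) auto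
qed

text \<open>A single value outside \<open>B\<close> refutes the inclusion at every later stage,
  whatever the size of \<open>B\<close>.\<close>

lemma eventually_prefix_subset_iff:
  "\<forall>\<^sub>F s in sequentially. \<mu> ` {..<s} \<subseteq> B \<longleftrightarrow> range \<mu> \<subseteq> B" for \<mu> :: "nat \<Rightarrow> 'a"
proof (cases "range \<mu> \<subseteq> B")
  case True
  then show ?thesis by (intro always_eventually) auto
next
  case False
  then obtain k where "\<mu> k \<notin> B" by auto
  then show ?thesis
    using False by (auto intro: eventually_mono [OF eventually_gt_at_top [of k]])
qed

lemma learnable_imp_tell_tale:
  assumes M: "learnable \<phi> E K" and ne: "{} \<notin> K" and E: "equiv UNIV E" and e: "W \<phi> e \<in> K"
  shows "\<exists>D. tell_tale \<phi> E K e D"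
proof -
  obtain M where M: "\<And>e \<mu>. W \<phi> e \<in> K \<Longrightarrow> enumeration_of \<mu> (W \<phi> e) \<Longrightarrow>
      \<exists>i. (i, e) \<in> E \<and> (\<forall>\<^sub>F s in sequentially. M (initial_segment \<mu> s) = i)"
    using M unfolding learnable_def by blast
  have nonempty: "W \<phi> e \<noteq> {}" using ne e by metis
  obtain \<sigma> where \<sigma>: "set \<sigma> \<subseteq> W \<phi> e" "\<And>\<tau>. set \<tau> \<subseteq> W \<phi> e \<Longrightarrow> M (\<sigma> @ \<tau>) = M \<sigma>"
    using exists_locking_sequence [OF nonempty, of M] M [OF e] by metis
  have conjecture: "(M \<sigma>, e') \<in> E"
    if e': "W \<phi> e' \<in> K" "set \<sigma> \<subseteq> W \<phi> e'" "W \<phi> e' \<subseteq> W \<phi> e" for e'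
  proof -
    have "W \<phi> e' \<noteq> {}" using ne e' by metis
    then obtain \<mu> where \<mu>: "enumeration_of \<mu> (W \<phi> e')" "initial_segment \<mu> (length \<sigma>) = \<sigma>"
      using exists_enumeration_extending e'(2) by blast
    then obtain i N where i: "(i, e') \<in> E" "\<And>s. s \<ge> N \<Longrightarrow> M (initial_segment \<mu> s) = i"
      using M [OF e'(1)] by (force simp: eventually_sequentially)
    \<comment> \<open>The \<open>N\<close> extra values push the stage past convergence; they lie in
      \<open>W \<phi> e\<close>, so locking still applies.\<close>
    let ?\<tau> = "map \<mu> [length \<sigma>..<length \<sigma> + N]"
    have "i = M (\<sigma> @ ?\<tau>)"
      using i(2) [of "length \<sigma> + N"] \<mu>(2) by (simp add: initial_segment_add)
    also have "\<dots> = M \<sigma>"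
      using \<mu>(1) e'(3) by (intro \<sigma>(2)) (auto simp: enumeration_of_def)
    finally show ?thesis using i(1) by simp
  qed
  have "tell_tale \<phi> E K e (set \<sigma>)"
    unfolding tell_tale_def
  proof (intro conjI allI impI notI)
    fix e' assume "W \<phi> e' \<in> K" "(e', e) \<notin> E" "set \<sigma> \<subseteq> W \<phi> e'" "W \<phi> e' \<subseteq> W \<phi> e"
    moreover from this have "(M \<sigma>, e') \<in> E" by (intro conjecture)
    \<comment> \<open>\<open>e\<close> is itself an instance of \<open>conjecture\<close>, so
      \<open>M \<sigma>\<close> links \<open>e'\<close> to \<open>e\<close>.\<close>
    moreover have "(M \<sigma>, e) \<in> E" using e \<sigma>(1) by (intro conjecture) auto
    ultimately show False using E by (meson equivE symE transE)
  qed (use \<sigma>(1) in auto)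
  then show ?thesis ..
qed

lemma tell_tales_imp_learnable:
  assumes "\<And>e. W \<phi> e \<in> K \<Longrightarrow> \<exists>D. tell_tale \<phi> E K e D" and "sym E"
  shows "learnable \<phi> E K"
proof -
  have "\<forall>e. \<exists>D. W \<phi> e \<in> K \<longrightarrow> tell_tale \<phi> E K e D"
    using assms(1) by blast
  then obtain D where D: "\<And>e. W \<phi> e \<in> K \<Longrightarrow> tell_tale \<phi> E K e (D e)"
    unfolding choice_iff by blast
  \<comment> \<open>When no index qualifies, the value is arbitrary; this is harmless, since
    \<open>e\<close> qualifies from some stage on.\<close>
  define M where "M \<sigma> = (LEAST i. W \<phi> i \<in> K \<and> D i \<subseteq> set \<sigma> \<and> set \<sigma> \<subseteq> W \<phi> i)" for \<sigma>
  show ?thesis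
    unfolding learnable_def
  proof (intro exI [of _ M] allI impI)
    fix e \<mu> assume e: "W \<phi> e \<in> K" and "enumeration_of \<mu> (W \<phi> e)"
    then have \<mu>: "range \<mu> = W \<phi> e" by (simp add: enumeration_of_def)
    \<comment> \<open>The limit of the condition defining \<open>M\<close>, with the data seen so
      far replaced by the whole range.\<close>
    define Q where "Q i \<longleftrightarrow> W \<phi> i \<in> K \<and> D i \<subseteq> range \<mu> \<and> range \<mu> \<subseteq> W \<phi> i" for i
    have "Q e" using D [OF e] e \<mu> by (auto simp: Q_def tell_tale_def)
    have "\<forall>\<^sub>F s in sequentially.
        (W \<phi> i \<in> K \<and> D i \<subseteq> \<mu> ` {..<s} \<and> \<mu> ` {..<s} \<subseteq> W \<phi> i) \<longleftrightarrow> Q i" for i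
    proof (cases "W \<phi> i \<in> K")
      case True
      then have "finite (D i)" using D by (simp add: tell_tale_def)
      from eventually_subset_prefix_iff [OF this, of \<mu>] eventually_prefix_subset_iff [of \<mu> "W \<phi> i"]
      show ?thesis by eventually_elim (simp add: Q_def)
    qed (simp add: Q_def)
    then have "\<forall>\<^sub>F s in sequentially. M (initial_segment \<mu> s) = (LEAST i. Q i)"
      unfolding M_def set_initial_segment using \<open>Q e\<close> by (rule eventually_const_Least)
    moreover have "(i, e) \<in> E" if "Q i" for i
    proof -
      have "W \<phi> i \<in> K" "D i \<subseteq> W \<phi> e" "W \<phi> e \<subseteq> W \<phi> i"
        using that unfolding Q_def \<mu> by blast+
      \<comment> \<open>The tell-tale used is that of the conjecture \<open>i\<close>, with
        \<open>e\<close> as competitor: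
        \<open>D i \<subseteq> W \<phi> e \<subseteq> W \<phi> i\<close> would be impossible for
        inequivalent indices.\<close>
      then have "(e, i) \<in> E"
        using D [of i] e unfolding tell_tale_def by blast
      then show ?thesis using \<open>sym E\<close> by (rule symD [rotated])
    qed
    then have "(LEAST i. Q i, e) \<in> E"
      using LeastI [of Q, OF \<open>Q e\<close>] .
    ultimately show "\<exists>i. (i, e) \<in> E \<and> (\<forall>\<^sub>F s in sequentially. M (initial_segment \<mu> s) = i)"
      by (intro exI conjI)
  qed
qed

theorem theorem3p3:
  fixes \<phi> :: "nat \<Rightarrow> nat \<Rightarrow> nat option"
    and E :: "nat rel"
    and K :: "nat set set"
  assumes "acceptable_enumeration \<phi>"
    and "\<forall>A \<in> K. ce_set A \<and> A \<noteq> {}"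
    and "equiv UNIV E"
    and "ce_equality \<phi> \<subseteq> E"
  shows "learnable \<phi> E K \<longleftrightarrow> (\<forall>e. W \<phi> e \<in> K \<longrightarrow> (\<exists>D. tell_tale \<phi> E K e D))"
proof -
  have "{} \<notin> K" using assms(2) by blast
  moreover have "sym E" using assms(3) by (rule equivE)
  ultimately show ?thesis
    using learnable_imp_tell_tale tell_tales_imp_learnable assms(3) by metis
qed

end
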